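(* Let $x\in\Sigma_q^n$ and $1\le t\le\min\{\ell-2,\frac{\ell+1+s}{2}\}$, where $0\le s<t$. Suppose that $\mathcal R'$ is obtained from $\mathcal R_\ell(\tilde x)$ by deleting $t$ arbitrary $\ell$-mers, and that $\mathcal R''$ is the consistent vector of $\ell$-mers obtained by inserting a minimum number $s$ of $\ell$-mers into $\mathcal R'$. Let $y=\mathcal R_\ell^{-1}(\mathcal R'')$. (i) The sequences $\tilde x$ and $y$ contain the same number of $(\ell,t,s)$-check patterns. (ii) Let $p'$ be the $i$-th $(\ell,t,s)$-check pattern in $y$, and let $p$ be the $i$-th $(\ell,t,s)$-check pattern in $\tilde x$. Then $p'$ and $p$ have the same minimum period. Moreover, either $p'=p$ (as sequences), or $p'$ is obtained from $p$ by deleting some complete minimum periods.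
   Context: $q\ge2$, $\Sigma_q=\{0,1,\dots,q-1\}$; $z_{[a,b]}=z_az_{a+1}\cdots z_b$ denotes a substring (substrings are identified with their positions, and are ordered from left to right). An $\ell$-mer is an element of $\Sigma_q^\ell$. Channel: two known $\ell$-mers $u,v\in\Sigma_q^\ell$ are fixed, and $\tilde x=uxv$, with coordinates indexed by $-\ell+1,\dots,n+\ell$, so that $\tilde x_{[-\ell+1,0]}=u$, $\tilde x_{[1,n]}=x$, $\tilde x_{[n+1,n+\ell]}=v$. The read vector is $\mathcal R_\ell(\tilde x)=(s_0,s_1,\dots,s_{n+\ell})$ with $s_i=\tilde x_{[i-\ell+1,i]}$. Deleting $\ell$-mers means passing to a (not necessarily contiguous) subvector; throughout it is assumed that the first and last $\ell$-mers $s_0$ and $s_{n+\ell}$ are not deleted. Consistency: two $\ell$-mers $y_1\cdots y_\ell$ and $z_1\cdots z_\ell$ (in this order) are consistent if $y_2\cdots y_\ell=z_1\cdots z_{\ell-1}$. A vector of $\ell$-mers is consistent if every two adjacent entries are consistent. For a consistent vector $(r_1,\dots,r_m)$ with $r_i=r_{i,1}\cdots r_{i,\ell}$, $\mathcal R_\ell^{-1}(r_1,\dots,r_m)$ denotes the sequence $r_{1,1}\cdots r_{1,\ell}r_{2,\ell}\cdots r_{m,\ell}$. Periodicity: a sequence $z$ of length at least $T+1$ is $T$-periodic (has period $T$) if $z_i=z_{i+T}$ for all $1\le i\le |z|-T$; its minimum period is its smallest period. A maximal $T$-periodic substring of $z$ is a $T$-periodic substring not contained in a longer $T$-periodic substring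 of $z$. Deleting several complete minimum periods from a periodic sequence with minimum period $T$ means applying several bursts of deletions (deletions of substrings), each of length divisible by $T$. Check patterns: for $0\le s<\min\{\ell-1,t\}$, a periodic substring $p$ of $z$ with minimum period $T$ is an $(\ell,t,s)$-check pattern in $z$ if (i) $T\le t-s$; (ii) $p$ is a maximal periodic substring of $z$ with minimum period $T$; (iii) $|p|\ge \ell-1-s$. *)

theory Defs
  imports Main "HOL-Library.Sublist"
begin

text \<open>
  Sequences are lists of natural numbers, with 0-based positions.  A coordinate \<open>c\<close> of
  \<open>u @ x @ v\<close> in the range \<open>- l + 1, ..., n + l\<close> is the list position \<open>c + l - 1\<close>.
\<close>

definition seqs :: "nat \<Rightarrow> nat \<Rightarrow> nat list set" where
  "seqs q n = {w. set w \<subseteq> {..<q} \<and> length w = n}"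

text \<open>Both end positions are included; used only for \<open>a \<le> b < length z\<close>.\<close>

definition substring :: "'a list \<Rightarrow> nat \<Rightarrow> nat \<Rightarrow> 'a list" where
  "substring z a b = map (\<lambda>i. z ! i) [a..<Suc b]"

definition read_vector :: "nat \<Rightarrow> 'a list \<Rightarrow> 'a list list" where
  "read_vector l z = map (\<lambda>i. take l (drop i z)) [0..<Suc (length z - l)]"

definition consistent :: "'a list list \<Rightarrow> bool" where
  "consistent R \<longleftrightarrow> successively (\<lambda>y z. tl y = butlast z) R"

definition inv_read_vector :: "'a list list \<Rightarrow> 'a list" where
  "inv_read_vector R = hd R @ map last (tl R)"

text \<open>Deletion acts on positions, since the same entry may occur several times in \<open>R\<close>.
  The first and the last entry are kept.\<close>

definition deletion :: "nat \<Rightarrow> 'a list \<Rightarrow> 'a list \<Rightarrow> bool" where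
  "deletion t R R' \<longleftrightarrow>
     (\<exists>D. D \<subseteq> {0<..<length R - 1} \<and> card D = t \<and> R' = nths R (- D))"

definition consistent_insertion ::
  "nat \<Rightarrow> nat \<Rightarrow> nat \<Rightarrow> nat list list \<Rightarrow> nat list list \<Rightarrow> bool" where
  "consistent_insertion q l s R' R'' \<longleftrightarrow>
     set R'' \<subseteq> seqs q l \<and> consistent R'' \<and> subseq R' R'' \<and> length R'' = length R' + s"

definition min_consistent_insertion ::
  "nat \<Rightarrow> nat \<Rightarrow> nat \<Rightarrow> nat list list \<Rightarrow> nat list list \<Rightarrow> bool" where
  "min_consistent_insertion q l s R' R'' \<longleftrightarrow>
     consistent_insertion q l s R' R'' \<and>
     (\<forall>s' S. consistent_insertion q l s' R' S \<longrightarrow> s \<le> s')"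

definition has_period :: "nat \<Rightarrow> 'a list \<Rightarrow> bool" where
  "has_period T z \<longleftrightarrow>
     T \<ge> 1 \<and> length z \<ge> T + 1 \<and> (\<forall>i < length z - T. z ! i = z ! (i + T))"

definition has_min_period :: "nat \<Rightarrow> 'a list \<Rightarrow> bool" where
  "has_min_period T z \<longleftrightarrow> has_period T z \<and> (\<forall>T'. has_period T' z \<longrightarrow> T \<le> T')"

definition maximal_periodic_substring :: "nat \<Rightarrow> 'a list \<Rightarrow> nat \<Rightarrow> nat \<Rightarrow> bool" where
  "maximal_periodic_substring T z a b \<longleftrightarrow>
     a \<le> b \<and> b < length z \<and> has_period T (substring z a b) \<and>
     (\<forall>c d. c \<le> a \<and> b \<le> d \<and> d < length z \<and> has_period T (substring z c d)
        \<longrightarrow> c = a \<and> d = b)"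

text \<open>The parameters are meant to satisfy \<open>s < min (l - 1) t\<close>, so that no
  subtraction below is truncated.  Under this condition the maximality in the paper, among
  the substrings with minimum period \<open>T\<close>, is the same as maximality among the
  \<open>T\<close>-periodic substrings: a \<open>T\<close>-periodic extension of a sequence with minimum
  period \<open>T\<close> has minimum period \<open>T\<close>.\<close>

definition check_pattern :: "nat \<Rightarrow> nat \<Rightarrow> nat \<Rightarrow> 'a list \<Rightarrow> nat \<Rightarrow> nat \<Rightarrow> bool" where
  "check_pattern l t s z a b \<longleftrightarrow>
     (\<exists>T. has_min_period T (substring z a b) \<and> T \<le> t - s \<and>
          maximal_periodic_substring T z a b \<and>
          length (substring z a b) \<ge> l - 1 - s)"

text \<open>The pairs (first position, last position) of all check patterns, from left to right:
  by first position, then by last position.  The second criterion never matters when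
  \<open>2 * t \<le> l + 1 + s\<close>, since then by Fine and Wilf two check patterns cannot
  start at the same position.\<close>

definition check_patterns :: "nat \<Rightarrow> nat \<Rightarrow> nat \<Rightarrow> 'a list \<Rightarrow> (nat \<times> nat) list" where
  "check_patterns l t s z =
     filter (\<lambda>(a, b). check_pattern l t s z a b)
       (List.product [0..<length z] [0..<length z])"

definition burst_deletion :: "nat \<Rightarrow> 'a list \<Rightarrow> 'a list \<Rightarrow> bool" where
  "burst_deletion T p p' \<longleftrightarrow>
     (\<exists>a b c. p = a @ b @ c \<and> b \<noteq> [] \<and> T dvd length b \<and> p' = a @ c)"

definition deletion_of_min_periods :: "'a list \<Rightarrow> 'a list \<Rightarrow> bool" where
  "deletion_of_min_periods p p' \<longleftrightarrow>
     (\<exists>T. has_min_period T p \<and> (burst_deletion T)\<^sup>+\<^sup>+ p p')"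

end

(* Minimality forces every gap of R' to receive at most as many reads as were deleted there.
   If a gap loses k reads and regains j < k, its two bounding reads overlap at two different
   offsets. This makes a stretch of length at least l - 1 - s periodic with period
   k - j <= t - s, and the effect on the word is to cut k - j letters out of the (longer)
   periodic stretch. So y arises from xt by finitely many such cuts.

   The hypothesis 2 t <= l + 1 + s is what Fine and Wilf need: the minimum period of the
   stretch divides k - j, and two different check patterns overlap in fewer than l - 1 - s
   positions. Hence a cut shortens exactly one check pattern, by a multiple of its minimum
   period, and every other one lies, together with the letters next to it, to one side of the
   cut and is merely shifted. *)

theory Submission
  imports Defs
begin

section \<open>Periods on windows\<close>

text \<open>The window is half-open and keeps absolute positions, so windows of one sequence can be
  intersected and united without reindexing. A window of length at most \<open>T\<close> passes
  vacuously.\<close>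

definition per :: "nat \<Rightarrow> (nat \<Rightarrow> 'a) \<Rightarrow> nat \<Rightarrow> nat \<Rightarrow> bool" where
  "per T w a b \<longleftrightarrow> (\<forall>i \<ge> a. i + T < b \<longrightarrow> w i = w (i + T))"

lemma perI: "(\<And>i. a \<le> i \<Longrightarrow> i + T < b \<Longrightarrow> w i = w (i + T)) \<Longrightarrow> per T w a b"
  by (simp add: per_def)

lemma perD: "per T w a b \<Longrightarrow> a \<le> i \<Longrightarrow> i + T < b \<Longrightarrow> w i = w (i + T)"
  by (simp add: per_def)

lemma per_mono: "per T w a b \<Longrightarrow> a \<le> a' \<Longrightarrow> b' \<le> b \<Longrightarrow> per T w a' b'"
  by (auto simp: per_def)

lemma per_add_mult:
  assumes "per T w a b" "a \<le> i" "i + k * T < b"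
  shows "w i = w (i + k * T)"
  using assms(3)
proof (induction k)
  case (Suc k)
  have "w i = w (i + k * T)" using Suc by simp
  also have "\<dots> = w (i + k * T + T)"
    using perD[OF assms(1), of "i + k * T"] assms(2) Suc.prems by (simp add: algebra_simps)
  finally show ?case by (simp add: algebra_simps)
qed simp

lemma per_cong_le:
  assumes "per T w a b" "a \<le> i" "i \<le> j" "j < b" "i mod T = j mod T"
  shows "w i = w j"
proof -
  have "T dvd j - i" using assms(3,5) mod_eq_dvd_iff_nat[of i j T] by simp
  then obtain k where "j = i + T * k"
    using assms(3) by (metis dvd_def le_add_diff_inverse)
  then show ?thesis using per_add_mult[OF assms(1,2), of k] assms(4) by (simp add: mult.commute)
qed

lemma per_cong:
  assumes "per T w a b" "a \<le> i" "i < b" "a \<le> j" "j < b" "i mod T = j mod T"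
  shows "w i = w j"
proof (cases "i \<le> j")
  case True
  then show ?thesis using per_cong_le[OF assms(1,2) True assms(5,6)] by simp
next
  case False
  then show ?thesis using per_cong_le[OF assms(1,4) _ assms(3) assms(6)[symmetric]] by simp
qed

lemma ex_congruent_in_window:
  assumes "(T::nat) \<ge> 1"
  obtains r where "a \<le> r" "r < a + T" "r mod T = i mod T"
proof
  \<comment> \<open>Adding \<open>T * a \<ge> a\<close> keeps the residue and makes the subtraction
    of \<open>a\<close> exact.\<close>
  let ?r = "a + (i + T * a - a) mod T"
  show "a \<le> ?r" by simp
  show "?r < a + T" using assms by simp
  have "a \<le> T * a" using assms by (cases T) auto
  then have "a + (i + T * a - a) = i + T * a" by linarith
  then show "?r mod T = i mod T" by (metis mod_add_right_eq mod_mult_self2)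
qed

text \<open>A window of length \<open>T\<close> meets every residue class mod \<open>T\<close>, so
  each value of the large window recurs in the small one, where period \<open>g\<close> applies;
  \<open>g dvd T\<close> makes residues mod \<open>g\<close> survive this transport.\<close>

lemma per_extend:
  assumes "per T w a b" "per g w a' b'" "a \<le> a'" "b' \<le> b" "a' + T \<le> b'" "g dvd T" "T \<ge> 1"
  shows "per g w a b"
proof (rule perI)
  fix i assume i: "a \<le> i" "i + g < b"
  obtain r where r: "a' \<le> r" "r < a' + T" "r mod T = i mod T"
    using ex_congruent_in_window[OF assms(7)] by blast
  obtain r' where r': "a' \<le> r'" "r' < a' + T" "r' mod T = (i + g) mod T"
    using ex_congruent_in_window[OF assms(7)] by blast
  have "w i = w r"
    by (rule per_cong[OF assms(1) _ _ _ _ r(3)[symmetric]]) (use i r(1,2) assms(3-5) in linarith)+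
  moreover have "w (i + g) = w r'"
    by (rule per_cong[OF assms(1) _ _ _ _ r'(3)[symmetric]])
      (use i r'(1,2) assms(3-5) in linarith)+
  moreover have "r mod g = r' mod g"
    using r(3) r'(3) assms(6) by (metis mod_mod_cancel mod_add_self2)
  then have "w r = w r'"
    by (intro per_cong[OF assms(2)]) (use r(1,2) r'(1,2) assms(5) in linarith)+
  ultimately show "w i = w (i + g)" by simp
qed

text \<open>The overlap has at least \<open>T\<close> positions, so each pair at distance
  \<open>T\<close> lies within one of the two windows.\<close>

lemma per_union:
  assumes "per T w a b" "per T w a' b'" "max a a' + T \<le> min b b'"
  shows "per T w (min a a') (max b b')"
proof (rule perI)
  fix i assume i: "min a a' \<le> i" "i + T < max b b'"
  have "a \<le> i \<and> i + T < b \<or> a' \<le> i \<and> i + T < b'" using i assms(3) by linarith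
  then show "w i = w (i + T)" using perD[OF assms(1)] perD[OF assms(2)] by blast
qed

text \<open>Euclid's algorithm by subtraction: dropping the last \<open>p\<close> positions turns
  the periods \<open>p < q\<close> into \<open>p\<close> and \<open>q - p\<close> with the same gcd,
  and \<open>per_extend\<close> carries the gcd back to the full window.\<close>

lemma fine_wilf:
  assumes "per p w a b" "per q w a b" "p \<ge> 1" "q \<ge> 1" "a + p + q \<le> b + gcd p q"
  shows "per (gcd p q) w a b"
  using assms
proof (induction "p + q" arbitrary: p q b rule: less_induct)
  case less
  have main: "per (gcd p q) w a b"
    if "p < q" "per p w a b" "per q w a b" "p \<ge> 1" "a + p + q \<le> b + gcd p q"
      "\<And>p' q' b'. p' + q' < p + q \<Longrightarrow> per p' w a b' \<Longrightarrow> per q' w a b' \<Longrightarrow> p' \<ge> 1 \<Longrightarrow> q' \<ge> 1 \<Longrightarrow>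
          a + p' + q' \<le> b' + gcd p' q' \<Longrightarrow> per (gcd p' q') w a b'" for p q b
  proof -
    have g: "gcd p (q - p) = gcd p q" using that(1) by (metis gcd_diff1_nat gcd.commute less_imp_le_nat)
    have "gcd p q \<le> q - p"
      using that(1) g by (metis gcd_le2_nat zero_less_diff less_numeral_extra(3))
    then have p: "a + p \<le> b - p" using that(5,1) by linarith
    have "per (q - p) w a (b - p)"
    proof (rule perI)
      fix i assume i: "a \<le> i" "i + (q - p) < b - p"
      have "w i = w (i + q)" using perD[OF that(3), of i] i that(1) by simp
      also have "\<dots> = w (i + (q - p))" using perD[OF that(2), of "i + (q - p)"] i that(1) by simp
      finally show "w i = w (i + (q - p))" .
    qed
    moreover have "per p w a (b - p)" using per_mono[OF that(2)] by simp
    ultimately have "per (gcd p (q - p)) w a (b - p)"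
      using that(6)[of p "q - p" "b - p"] that(1,4,5) p g by simp
    then show ?thesis
      using per_extend[OF that(2), of "gcd p q" a "b - p"] p g that(4) by simp
  qed
  consider "p < q" | "q < p" | "p = q" by linarith
  then show ?case
  proof cases
    case 1
    show ?thesis by (rule main[OF 1 less.prems(1,2,3,5) less.hyps])
  next
    case 2
    have "a + q + p \<le> b + gcd q p" using less.prems(5) by (simp add: gcd.commute)
    moreover have "per (gcd p' q') w a b'"
      if "p' + q' < q + p" "per p' w a b'" "per q' w a b'" "p' \<ge> 1" "q' \<ge> 1"
        "a + p' + q' \<le> b' + gcd p' q'" for p' q' b'
      by (rule less.hyps[OF _ that(2-6)]) (use that(1) in linarith)
    ultimately have "per (gcd q p) w a b" by (rule main[OF 2 less.prems(2,1,4)])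
    then show ?thesis by (simp add: gcd.commute)
  qed (use less.prems(1) in simp)
qed

section \<open>Check patterns as long maximal runs\<close>

lemma length_substring [simp]: "length (substring z a b) = Suc b - a"
  by (simp add: substring_def del: upt_Suc)

lemma nth_substring: "i < Suc b - a \<Longrightarrow> substring z a b ! i = z ! (a + i)"
  by (simp add: substring_def del: upt_Suc)

lemma substring_eq_take_drop: "b < length z \<Longrightarrow> substring z a b = take (Suc b - a) (drop a z)"
  by (rule nth_equalityI) (auto simp: nth_substring)

lemma has_period_substring:
  "has_period T (substring z a b) \<longleftrightarrow> 1 \<le> T \<and> a + T \<le> b \<and> per T ((!) z) a (Suc b)"
proof -
  have "(\<forall>i < Suc b - a - T. substring z a b ! i = substring z a b ! (i + T))
      \<longleftrightarrow> per T ((!) z) a (Suc b)" (is "?L \<longleftrightarrow> ?R")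
  proof
    assume L: ?L
    show ?R
    proof (rule perI)
      fix i assume i: "a \<le> i" "i + T < Suc b"
      then have "i - a < Suc b - a - T" by linarith
      then have "substring z a b ! (i - a) = substring z a b ! (i - a + T)" using L by blast
      then show "z ! i = z ! (i + T)" using i by (simp add: nth_substring)
    qed
  next
    assume R: ?R
    show ?L
    proof (intro allI impI)
      fix i assume "i < Suc b - a - T"
      then show "substring z a b ! i = substring z a b ! (i + T)"
        using perD[OF R, of "a + i"] by (simp add: nth_substring add.assoc)
    qed
  qed
  then show ?thesis by (auto simp: has_period_def)
qed

lemma has_min_period_substring:
  "has_min_period T (substring z a b) \<longleftrightarrow>
     1 \<le> T \<and> a + T \<le> b \<and> per T ((!) z) a (Suc b) \<and>
     (\<forall>T' \<ge> 1. per T' ((!) z) a (Suc b) \<longrightarrow> T \<le> T')"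
  unfolding has_min_period_def has_period_substring
  by (metis add_le_cancel_left nat_le_linear le_trans)

text \<open>Periodicity restricts to subwindows, so an extension exists only if one by a single
  letter does; maximality is a mismatch on each side where \<open>z\<close> goes on.\<close>

lemma maximal_periodic_substring_iff:
  "maximal_periodic_substring T z a b \<longleftrightarrow>
     b < length z \<and> 1 \<le> T \<and> a + T \<le> b \<and> per T ((!) z) a (Suc b) \<and>
     (a > 0 \<longrightarrow> z ! (a - 1) \<noteq> z ! (a - 1 + T)) \<and>
     (Suc b < length z \<longrightarrow> z ! (Suc b - T) \<noteq> z ! Suc b)" (is "?L \<longleftrightarrow> ?R")
proof
  assume L: ?L
  then have b: "b < length z" "1 \<le> T" "a + T \<le> b" and p: "per T ((!) z) a (Suc b)"
    and mx: "\<And>c d. c \<le> a \<Longrightarrow> b \<le> d \<Longrightarrow> d < length z \<Longrightarrow> c + T \<le> d \<Longrightarrow>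
      per T ((!) z) c (Suc d) \<Longrightarrow> c = a \<and> d = b"
    unfolding maximal_periodic_substring_def has_period_substring by blast+
  have "z ! (a - 1) \<noteq> z ! (a - 1 + T)" if "a > 0"
  proof
    assume eq: "z ! (a - 1) = z ! (a - 1 + T)"
    have "per T ((!) z) (a - 1) (Suc b)"
    proof (rule perI)
      fix i assume i: "a - 1 \<le> i" "i + T < Suc b"
      then consider "i = a - 1" | "a \<le> i" by linarith
      then show "z ! i = z ! (i + T)" using eq perD[OF p] i by cases auto
    qed
    moreover have "a - 1 + T \<le> b" using b that by linarith
    ultimately have "a - 1 = a" using mx[of "a - 1" b] b by simp
    then show False using that by simp
  qed
  moreover have "z ! (Suc b - T) \<noteq> z ! Suc b" if "Suc b < length z"
  proof
    assume eq: "z ! (Suc b - T) = z ! Suc b"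
    have "per T ((!) z) a (Suc (Suc b))"
    proof (rule perI)
      fix i assume i: "a \<le> i" "i + T < Suc (Suc b)"
      then consider "i = Suc b - T" | "i + T < Suc b" by linarith
      then show "z ! i = z ! (i + T)" using eq perD[OF p] i b by cases auto
    qed
    then show False using mx[of a "Suc b"] b that by auto
  qed
  ultimately show ?R using b p by blast
next
  assume R: ?R
  have "c = a \<and> d = b"
    if "c \<le> a" "b \<le> d" "d < length z" "per T ((!) z) c (Suc d)" for c d
  proof -
    have "\<not> c < a"
    proof
      assume "c < a"
      then have "c \<le> a - 1" "a - 1 + T < Suc d" using R that(2) by linarith+
      then show False using perD[OF that(4)] R \<open>c < a\<close> by force
    qed
    moreover have "\<not> b < d"
    proof
      assume "b < d"
      then have "c \<le> Suc b - T" "Suc b - T + T = Suc b" "Suc b < length z"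
        using R that(1,3) by linarith+
      then show False using perD[OF that(4), of "Suc b - T"] R \<open>b < d\<close> by simp
    qed
    ultimately show ?thesis using that by auto
  qed
  then show ?L using R by (auto simp: maximal_periodic_substring_def has_period_substring)
qed

text \<open>A check pattern with its period made explicit: \<open>M\<close> stands for the least
  length \<open>l - 1 - s\<close>, \<open>D\<close> for the largest period
  \<open>t - s\<close>.\<close>

definition long_run :: "nat \<Rightarrow> nat \<Rightarrow> nat \<Rightarrow> 'a list \<Rightarrow> nat \<Rightarrow> nat \<Rightarrow> bool" where
  "long_run M D T z a b \<longleftrightarrow>
     1 \<le> T \<and> T \<le> D \<and> b < length z \<and> a + T \<le> b \<and> a + M \<le> Suc b \<and>
     per T ((!) z) a (Suc b) \<and> (\<forall>T' \<ge> 1. per T' ((!) z) a (Suc b) \<longrightarrow> T \<le> T') \<and>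
     (a > 0 \<longrightarrow> z ! (a - 1) \<noteq> z ! (a - 1 + T)) \<and>
     (Suc b < length z \<longrightarrow> z ! (Suc b - T) \<noteq> z ! Suc b)"

lemma check_pattern_iff_long_run:
  "check_pattern l t s z a b \<longleftrightarrow> (\<exists>T. long_run (l - 1 - s) (t - s) T z a b)"
proof -
  have "a + T \<le> b \<Longrightarrow> a + M \<le> Suc b \<longleftrightarrow> M \<le> Suc b - a" for M T
    by linarith
  then show ?thesis
    unfolding check_pattern_def has_min_period_substring maximal_periodic_substring_iff long_run_def
      length_substring
    by (intro ex_cong1) blast
qed

lemma long_run_min_period: "long_run M D T z a b \<Longrightarrow> has_min_period T (substring z a b)"
  by (auto simp: long_run_def has_min_period_substring)

lemma long_run_maximal: "long_run M D T z a b \<Longrightarrow> maximal_periodic_substring T z a b"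
  by (auto simp: long_run_def maximal_periodic_substring_iff)

text \<open>On \<open>M\<close> common positions Fine and Wilf yield the gcd of both periods, and
  \<open>per_extend\<close> spreads it over both runs. Minimality then makes the periods equal, and
  the union of the runs contradicts maximality.\<close>

lemma long_run_overlap:
  assumes "long_run M D T z a b" "long_run M D T' z a' b'" "(a, b) \<noteq> (a', b')"
    and "D + 1 \<le> M" "2 * D \<le> M + 2"
  shows "min b b' + 1 < max a a' + M"
proof (rule ccontr)
  assume "\<not> ?thesis"
  then have ov: "max a a' + M \<le> Suc (min b b')" by simp
  let ?g = "gcd T T'"
  note r = assms(1)[unfolded long_run_def] and r' = assms(2)[unfolded long_run_def]
  have g1: "?g \<ge> 1" using r by (simp add: Suc_le_eq)
  \<comment> \<open>Distinct periods sum to at most \<open>2 * D - 1 \<le> M + 1\<close>, and the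
    gcd is at least 1.\<close>
  have "T + T' \<le> M + ?g"
  proof (cases "T = T'")
    case False
    then have "T + T' \<le> 2 * D - 1" using r r' by linarith
    then show ?thesis using g1 assms(5) by linarith
  qed (use r assms(4) in auto)
  then have len: "max a a' + T + T' \<le> Suc (min b b') + ?g" using ov by linarith
  have "per T ((!) z) (max a a') (Suc (min b b'))"
    by (rule per_mono[of T _ a "Suc b"]) (use r in auto)
  moreover have "per T' ((!) z) (max a a') (Suc (min b b'))"
    by (rule per_mono[of T' _ a' "Suc b'"]) (use r' in auto)
  ultimately have pg: "per ?g ((!) z) (max a a') (Suc (min b b'))"
    using fine_wilf len r r' by blast
  have "per ?g ((!) z) a (Suc b)"
    by (rule per_extend[OF _ pg, of T]) (use r ov assms(4) in auto)
  then have "T \<le> ?g" using r g1 by blast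
  moreover have "per ?g ((!) z) a' (Suc b')"
    by (rule per_extend[OF _ pg, of T']) (use r' ov assms(4) in auto)
  then have "T' \<le> ?g" using r' g1 by blast
  ultimately have T: "T' = T"
    using r r' by (metis gcd_le1_nat gcd_le2_nat le_antisym le_trans not_one_le_zero)
  have "per T ((!) z) (min a a') (max (Suc b) (Suc b'))"
    by (rule per_union) (use r r' ov assms(4) T in auto)
  moreover have "max (Suc b) (Suc b') = Suc (max b b')" by simp
  moreover have "min a a' + T \<le> max b b'" using r by linarith
  ultimately have hull: "has_period T (substring z (min a a') (max b b'))"
    using r unfolding has_period_substring by metis
  have "maximal_periodic_substring T z a b" "maximal_periodic_substring T z a' b'"
    using long_run_maximal[OF assms(1)] long_run_maximal[OF assms(2)] T by simp_all
  moreover have "max b b' < length z" using r r' by simp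
  ultimately have "min a a' = a \<and> max b b' = b" "min a a' = a' \<and> max b b' = b'"
    using hull unfolding maximal_periodic_substring_def by (meson max.cobounded1 max.cobounded2 min.cobounded1 min.cobounded2)+
  then show False using assms(3) by simp
qed

text \<open>A run is determined by its letters and the letter next to it on either side.
  \<open>z'\<close> may end where \<open>z\<close> goes on, since maximality asks nothing at an end
  of the word.\<close>

lemma long_run_transfer:
  assumes "long_run M D T z a b" "Suc b' - a' = Suc b - a" "a' \<le> b'" "b' < length z'"
    and "\<And>j. a + j \<le> b \<Longrightarrow> z' ! (a' + j) = z ! (a + j)"
    and "a' > 0 \<Longrightarrow> a > 0 \<and> z' ! (a' - 1) = z ! (a - 1)"
    and "Suc b' < length z' \<Longrightarrow> Suc b < length z \<and> z' ! Suc b' = z ! Suc b"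
  shows "long_run M D T z' a' b'"
proof -
  note r = assms(1)[unfolded long_run_def]
  have len: "b' = a' + (b - a)" using assms(2,3) r by linarith
  have p: "per U ((!) z') a' (Suc b') \<longleftrightarrow> per U ((!) z) a (Suc b)" for U
  proof
    assume p: "per U ((!) z') a' (Suc b')"
    show "per U ((!) z) a (Suc b)"
    proof (rule perI)
      fix i assume i: "a \<le> i" "i + U < Suc b"
      then show "z ! i = z ! (i + U)"
        using perD[OF p, of "a' + (i - a)"] assms(5)[of "i - a"] assms(5)[of "i - a + U"] len
        by (simp add: add.assoc)
    qed
  next
    assume p: "per U ((!) z) a (Suc b)"
    show "per U ((!) z') a' (Suc b')"
    proof (rule perI)
      fix i assume i: "a' \<le> i" "i + U < Suc b'"
      then obtain k where k: "i = a' + k" by (auto dest: le_Suc_ex)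
      then have "a + (k + U) \<le> b" using i(2) len r by linarith
      then show "z' ! i = z' ! (i + U)"
        using perD[OF p, of "a + k"] assms(5)[of k] assms(5)[of "k + U"] k
        by (simp add: add.assoc)
    qed
  qed
  have "z' ! (a' - 1) \<noteq> z' ! (a' - 1 + T)" if "a' > 0"
  proof -
    have "a > 0" and e: "z' ! (a' - 1) = z ! (a - 1)" using assms(6) that by auto
    moreover have "a' + (T - 1) = a' - 1 + T" "a + (T - 1) = a - 1 + T" "a + (T - 1) \<le> b"
      using r that \<open>a > 0\<close> by linarith+
    then have "z' ! (a' - 1 + T) = z ! (a - 1 + T)" using assms(5)[of "T - 1"] by simp
    ultimately show ?thesis using r by simp
  qed
  moreover have "z' ! (Suc b' - T) \<noteq> z' ! Suc b'" if "Suc b' < length z'"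
  proof -
    have "Suc b < length z" and e: "z' ! Suc b' = z ! Suc b" using assms(7) that by auto
    moreover have "a + T \<le> b" using r by blast
    then have "a' + (Suc b - a - T) = Suc b' - T" "a + (Suc b - a - T) = Suc b - T"
      using len by simp_all
    then have "z' ! (Suc b' - T) = z ! (Suc b - T)"
      using assms(5)[of "Suc b - a - T"] r by auto
    ultimately show ?thesis using r by simp
  qed
  ultimately show ?thesis
    using r assms(4) p len unfolding long_run_def by auto
qed

text \<open>A longest \<open>T\<close>-periodic window around the given one is maximal, and every
  period of it restricts to the given window, so \<open>T\<close> stays minimal.\<close>

lemma ex_long_run_extending:
  assumes "per T ((!) z) a b" "b \<le> length z" "a + D < b" "a + M \<le> b" "1 \<le> T" "T \<le> D"
    and "\<And>T'. 1 \<le> T' \<Longrightarrow> per T' ((!) z) a b \<Longrightarrow> T \<le> T'"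
  obtains a0 b0 where "long_run M D T z a0 b0" "a0 \<le> a" "b \<le> Suc b0"
proof -
  define P where "P = (\<lambda>(c, e). c \<le> a \<and> b \<le> Suc e \<and> e < length z \<and> per T ((!) z) c (Suc e))"
  have "P (a, b - 1)" using assms by (auto simp: P_def)
  moreover have "\<forall>y. P y \<longrightarrow> snd y - fst y < length z" by (auto simp: P_def)
  ultimately obtain w where w: "P w" "\<forall>y. P y \<longrightarrow> snd y - fst y \<le> snd w - fst w"
    using ex_has_greatest_nat[of P "(a, b - 1)" "\<lambda>y. snd y - fst y" "length z"] by auto
  obtain a0 b0 where [simp]: "w = (a0, b0)" by fastforce
  have ab: "a0 \<le> a" "b \<le> Suc b0" "b0 < length z" "per T ((!) z) a0 (Suc b0)"
    using w(1) by (auto simp: P_def)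
  have "maximal_periodic_substring T z a0 b0"
    unfolding maximal_periodic_substring_def
  proof (intro conjI allI impI)
    fix c e assume ce: "c \<le> a0 \<and> b0 \<le> e \<and> e < length z \<and> has_period T (substring z c e)"
    then have "P (c, e)" using ab by (auto simp: P_def has_period_substring)
    then have "e - c \<le> b0 - a0" using w(2) by fastforce
    moreover have "a0 \<le> b0" using ab assms by linarith
    ultimately show "c = a0" "e = b0" using ce by linarith+
  qed (use ab assms in \<open>auto simp: has_period_substring\<close>)
  moreover have "T \<le> T'" if "T' \<ge> 1" "per T' ((!) z) a0 (Suc b0)" for T'
    by (rule assms(7)[OF that(1) per_mono[OF that(2)]]) (use ab in auto)
  ultimately have "long_run M D T z a0 b0"
    using ab assms unfolding maximal_periodic_substring_iff long_run_def by auto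
  then show ?thesis using that ab by blast
qed

section \<open>The list of check patterns\<close>

lemma sorted_wrt_product:
  assumes "sorted_wrt (<) xs" "sorted_wrt (<) ys"
  shows "sorted_wrt (\<lambda>(a, b) (a', b'). a < a' \<or> a = a' \<and> b < b')
    (List.product xs (ys :: nat list) :: (nat \<times> nat) list)"
  using assms by (induction xs) (auto simp: sorted_wrt_append sorted_wrt_map)

text \<open>By asymmetry the heads agree. This will identify the patterns of a shortened word from
  their set alone, without tracking indices.\<close>

lemma sorted_wrt_same_set_imp_eq:
  assumes "sorted_wrt P xs" "sorted_wrt P ys" "set xs = set ys"
    and "\<And>x y. P x y \<Longrightarrow> \<not> P y x"
  shows "xs = ys"
  using assms(1-3)
proof (induction xs arbitrary: ys)
  case (Cons x xs)
  then obtain y ys' where [simp]: "ys = y # ys'" by (cases ys) auto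
  have irr: "\<not> P v v" for v using assms(4) by blast
  have "x = y"
  proof (rule ccontr)
    assume "x \<noteq> y"
    then have "x \<in> set ys'" "y \<in> set xs" using Cons.prems(3) by auto
    then show False using Cons.prems assms(4) by auto
  qed
  moreover have "x \<notin> set xs" "y \<notin> set ys'" using Cons.prems irr by auto
  ultimately have "set xs = set ys'" using Cons.prems(3) by auto
  then show ?case using Cons \<open>x = y\<close> by auto
qed simp

lemma set_check_patterns:
  "set (check_patterns l t s z) = {(a, b). \<exists>T. long_run (l - 1 - s) (t - s) T z a b}"
  unfolding check_patterns_def
  by (auto simp: check_pattern_iff_long_run) (auto simp: long_run_def)

text \<open>Two patterns with the same start would share at least \<open>l - 1 - s\<close>
  positions, against \<open>long_run_overlap\<close>. So the start alone orders the
  patterns.\<close>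

lemma sorted_check_patterns:
  assumes "t - s + 1 \<le> l - 1 - s" "2 * (t - s) \<le> l - 1 - s + 2"
  shows "sorted_wrt (\<lambda>p p'. fst p < fst p') (check_patterns l t s z)"
proof -
  have s: "sorted_wrt (\<lambda>(a, b) (a', b'). a < a' \<or> a = a' \<and> b < b') (check_patterns l t s z)"
    unfolding check_patterns_def by (intro sorted_wrt_filter sorted_wrt_product) auto
  show ?thesis
  proof (rule sorted_wrt_mono_rel[OF _ s])
    fix v v'
    assume v: "v \<in> set (check_patterns l t s z)" "v' \<in> set (check_patterns l t s z)"
      "(case v of (a, b) \<Rightarrow> \<lambda>(a', b'). a < a' \<or> a = a' \<and> b < b') v'"
    obtain a b a' b' where ab: "v = (a, b)" "v' = (a', b')" by fastforce
    then obtain T T' where r: "long_run (l - 1 - s) (t - s) T z a b"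
      "long_run (l - 1 - s) (t - s) T' z a' b'"
      using v(1,2) by (auto simp: set_check_patterns)
    have *: "a < a' \<or> a = a' \<and> b < b'" using v(3) ab by simp
    have "min b b' + 1 < max a a' + (l - 1 - s)"
      by (rule long_run_overlap[OF r _ assms]) (use * in auto)
    moreover have "a + (l - 1 - s) \<le> Suc b" using r(1) unfolding long_run_def by blast
    ultimately have "a < a'" using * by linarith
    then show "fst v < fst v'" using ab by simp
  qed
qed

section \<open>Cutting one power out of a run\<close>

text \<open>The equation \<open>e @ c = c @ f\<close> says that \<open>e @ c\<close> has period
  \<open>length e\<close>, and that deleting \<open>e\<close> before \<open>c\<close> is the same as
  deleting \<open>f\<close> after \<open>c\<close>.\<close>

definition cut :: "nat \<Rightarrow> nat \<Rightarrow> 'a list \<Rightarrow> 'a list \<Rightarrow> bool" where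
  "cut M D z z' \<longleftrightarrow> (\<exists>\<alpha> c e f \<beta>. z = \<alpha> @ e @ c @ \<beta> \<and> z' = \<alpha> @ c @ \<beta> \<and> e @ c = c @ f \<and>
     e \<noteq> [] \<and> length e \<le> D \<and> M \<le> length c)"

definition shortening :: "'a list \<Rightarrow> 'a list \<Rightarrow> bool" where
  "shortening p p' \<longleftrightarrow> (\<exists>T. has_min_period T p \<and> has_min_period T p') \<and>
     (p' = p \<or> deletion_of_min_periods p p')"

lemma has_min_period_unique: "has_min_period T p \<Longrightarrow> has_min_period T' p \<Longrightarrow> T = T'"
  unfolding has_min_period_def by (meson le_antisym)

text \<open>The middle word has only one minimum period, so both chains of burst deletions use the
  same \<open>T\<close> and can be concatenated.\<close>

lemma shortening_trans:
  assumes "shortening p p'" "shortening p' p''"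
  shows "shortening p p''"
proof -
  obtain T where T: "has_min_period T p" "has_min_period T p'"
    using assms(1) by (auto simp: shortening_def)
  obtain T' where "has_min_period T' p'" "has_min_period T' p''"
    using assms(2) by (auto simp: shortening_def)
  with T have T'': "has_min_period T p''" using has_min_period_unique by metis
  have "(burst_deletion T)\<^sup>*\<^sup>* p p'" "(burst_deletion T)\<^sup>*\<^sup>* p' p''"
    using assms T has_min_period_unique unfolding shortening_def deletion_of_min_periods_def
    by (metis rtranclp.rtrancl_refl tranclp_into_rtranclp)+
  then have "(burst_deletion T)\<^sup>*\<^sup>* p p''" by simp
  then show ?thesis using T T'' unfolding shortening_def deletion_of_min_periods_def
    by (metis rtranclpD)
qed

definition pattern_words :: "nat \<Rightarrow> nat \<Rightarrow> nat \<Rightarrow> 'a list \<Rightarrow> 'a list list" where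
  "pattern_words l t s z = map (\<lambda>(a, b). substring z a b) (check_patterns l t s z)"

text \<open>By Fine and Wilf the least period of \<open>c\<close> divides \<open>length e\<close>,
  so the run containing \<open>e @ c\<close> loses whole periods. It stays maximal, since the
  mismatches at its ends lie in parts shared by \<open>z\<close> and \<open>z'\<close>.\<close>

lemma cut_runs:
  assumes z: "z = \<alpha> @ e @ c @ \<beta>" and z': "z' = \<alpha> @ c @ \<beta>" and ec: "e @ c = c @ f"
    and e: "e \<noteq> []" "length e \<le> D" and c: "M \<le> length c"
    and DM: "D + 1 \<le> M" "2 * D \<le> M + 2"
  obtains T a0 b0 where
    "long_run M D T z a0 b0" "long_run M D T z' a0 (b0 - length e)"
    "a0 \<le> length \<alpha>" "length \<alpha> + length e + length c \<le> Suc b0" "T dvd length e"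
proof -
  let ?A = "length \<alpha>" and ?L = "length c" and ?d = "length e"
  have z2: "z = \<alpha> @ c @ f @ \<beta>" using z ec by (metis append.assoc)
  have pre: "z' ! i = z ! i" if "i < ?A + ?L" for i
    using that by (auto simp: z2 z' nth_append)
  have suf: "z' ! i = z ! (i + ?d)" if "?A \<le> i" for i
    using that by (auto simp: z z' nth_append)
  have d: "1 \<le> ?d" using e(1) by (simp add: Suc_le_eq)
  \<comment> \<open>\<open>z'\<close> agrees with \<open>z\<close> up to the end of
    \<open>c\<close>, and with \<open>z\<close> shifted by \<open>?d\<close> from the start of
    \<open>c\<close> on; within \<open>c\<close> both hold.\<close>
  have per_d: "per ?d ((!) z) ?A (?A + ?L + ?d)"
    by (rule perI) (metis pre suf add.commute add_less_cancel_right)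
  \<comment> \<open>Only the copy of \<open>c\<close> right after \<open>\<alpha>\<close> is
    measured: it occurs in both words, so \<open>T\<close> is minimal for the runs of both.\<close>
  let ?Q = "\<lambda>T. 1 \<le> T \<and> per T ((!) z) ?A (?A + ?L)"
  define T where "T = (LEAST T. ?Q T)"
  have Qd: "?Q ?d" using per_mono[OF per_d] d by simp
  have T: "?Q T" unfolding T_def by (rule LeastI[of ?Q, OF Qd])
  have Tmin: "T \<le> T'" if "?Q T'" for T' unfolding T_def by (rule Least_le[of ?Q, OF that])
  have Td: "T \<le> ?d" by (rule Tmin[OF Qd])
  have g1: "gcd T ?d \<ge> 1" using d by (simp add: Suc_le_eq)
  have "T + ?d \<le> M + gcd T ?d"
  proof (cases "T = ?d")
    case False
    then show ?thesis using Td g1 e(2) DM by linarith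
  qed (use e(2) DM in auto)
  then have "per (gcd T ?d) ((!) z) ?A (?A + ?L)"
    by (intro fine_wilf) (use T Qd c in auto)
  then have "T \<le> gcd T ?d" by (intro Tmin) (use g1 in simp)
  then have dvd: "T dvd ?d"
    using T by (metis gcd_dvd2 gcd_le1_nat le_antisym not_one_le_zero)
  have per_T: "per T ((!) z) ?A (?A + ?L + ?d)"
    by (rule per_extend[OF per_d conjunct2[OF T]]) (use dvd d c e DM in auto)
  have minT: "T \<le> T'" if "1 \<le> T'" "per T' ((!) z) ?A (?A + ?L + ?d)" for T'
    by (rule Tmin) (use that per_mono[OF that(2)] in simp)
  have "?A + ?L + ?d \<le> length z" "?A + D < ?A + ?L + ?d" "?A + M \<le> ?A + ?L + ?d" "1 \<le> T" "T \<le> D"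
    using z c DM T Td e(2) by auto
  then obtain a0 b0 where run: "long_run M D T z a0 b0" and ab: "a0 \<le> ?A" "?A + ?L + ?d \<le> Suc b0"
    using ex_long_run_extending[OF per_T _ _ _ _ _ minT] by blast
  note r = run[unfolded long_run_def]
  have "long_run M D T z' a0 (b0 - ?d)"
    unfolding long_run_def
  proof (intro conjI allI impI)
    show "b0 - ?d < length z'" using r ab c DM z z' by auto
    show "a0 + T \<le> b0 - ?d" "a0 + M \<le> Suc (b0 - ?d)" using ab c DM Td e by linarith+
    show "per T ((!) z') a0 (Suc (b0 - ?d))"
    proof (rule perI)
      fix i assume i: "a0 \<le> i" "i + T < Suc (b0 - ?d)"
      show "z' ! i = z' ! (i + T)"
      \<comment> \<open>Since \<open>c\<close> is longer than \<open>T\<close>, a pair at distance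
        \<open>T\<close> lies in the shared prefix or in the shared suffix.\<close>
      proof (cases "i + T < ?A + ?L")
        case True
        moreover have "z ! i = z ! (i + T)"
          by (rule perD[of T "(!) z" a0 "Suc b0"]) (use r i in auto)
        ultimately show ?thesis using pre[of i] pre[of "i + T"] by simp
      next
        case False
        then have "?A \<le> i" using c DM Td e by linarith
        then have "z' ! i = z ! (i + ?d)" "z' ! (i + T) = z ! (i + ?d + T)"
          using suf[of i] suf[of "i + T"] by (simp_all add: ac_simps)
        moreover have "z ! (i + ?d) = z ! (i + ?d + T)"
          by (rule perD[of T "(!) z" a0 "Suc b0"]) (use r i in auto)
        ultimately show ?thesis by simp
      qed
    qed
    show "T \<le> T'" if "1 \<le> T'" "per T' ((!) z') a0 (Suc (b0 - ?d))" for T'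
    proof (rule Tmin, intro conjI perI)
      fix i assume i: "?A \<le> i" "i + T' < ?A + ?L"
      then show "z ! i = z ! (i + T')"
        using pre[of i] pre[of "i + T'"] perD[OF that(2), of i] ab by simp
    qed fact
    show "z' ! (a0 - 1) \<noteq> z' ! (a0 - 1 + T)" if "0 < a0"
    proof -
      have "a0 - 1 + T < ?A + ?L" using ab c DM Td e that by linarith
      then show ?thesis using pre[of "a0 - 1"] pre[of "a0 - 1 + T"] r that by simp
    qed
    show "z' ! (Suc (b0 - ?d) - T) \<noteq> z' ! Suc (b0 - ?d)" if "Suc (b0 - ?d) < length z'"
    proof -
      have "?A \<le> Suc (b0 - ?d) - T" "?A \<le> Suc (b0 - ?d)"
        "Suc (b0 - ?d) - T + ?d = Suc b0 - T" "Suc (b0 - ?d) + ?d = Suc b0"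
        using ab c DM Td e by linarith+
      moreover have "Suc b0 < length z"
        using that z z' ab c DM by auto
      ultimately show ?thesis
        using suf[of "Suc (b0 - ?d) - T"] suf[of "Suc (b0 - ?d)"] r by simp
    qed
  qed (use r in auto)
  then show ?thesis using that run ab dvd by (simp add: ac_simps)
qed

text \<open>Another run meets the run from \<open>a'\<close> to \<open>b'\<close> in fewer than
  \<open>M\<close> positions, so it must leave that run on one side. The strict bounds keep the
  adjacent letter on that side too. \<open>k\<close> will be the length cut out for
  \<open>z\<close>, and 0 for \<open>z'\<close>.\<close>

lemma long_run_beside_window:
  assumes "long_run M D T z a b" "long_run M D T' z a' b'" "(a, b) \<noteq> (a', b')"
    and "D + 1 \<le> M" "2 * D \<le> M + 2" "a' \<le> A" "A + M + k \<le> Suc b'"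
  shows "a < A \<and> Suc b < A + M \<or> A + k < a \<and> A + M + k \<le> b"
proof -
  have "a + M \<le> Suc b" using assms(1) unfolding long_run_def by blast
  then show ?thesis using long_run_overlap[OF assms(1-5)] assms(6,7) by linarith
qed

text \<open>Patterns to the left of the cut stay, those to its right move by
  \<open>length e\<close>, and the one containing the cut loses the factor \<open>e\<close>. This
  correspondence is bijective and preserves the order.\<close>

lemma cut_pattern_words:
  assumes "cut M D z z'" and M: "M = l - 1 - s" and D: "D = t - s"
    and DM: "D + 1 \<le> M" "2 * D \<le> M + 2"
  shows "list_all2 shortening (pattern_words l t s z) (pattern_words l t s z')"
proof -
  obtain \<alpha> c e f \<beta> where z: "z = \<alpha> @ e @ c @ \<beta>" and z': "z' = \<alpha> @ c @ \<beta>" and ec: "e @ c = c @ f"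
    and e: "e \<noteq> []" "length e \<le> D" and c: "M \<le> length c"
    using assms(1) unfolding cut_def by blast
  let ?A = "length \<alpha>" and ?L = "length c" and ?d = "length e"
  obtain T a0 b0 where P: "long_run M D T z a0 b0" and P': "long_run M D T z' a0 (b0 - ?d)"
    and ab: "a0 \<le> ?A" "?A + ?d + ?L \<le> Suc b0" and dvd: "T dvd ?d"
    by (rule cut_runs[OF z z' ec e c DM])
  have "z = \<alpha> @ c @ f @ \<beta>" using z ec by (metis append.assoc)
  then have pre: "z' ! i = z ! i" if "i < ?A + ?L" for i
    using that by (auto simp: z' nth_append)
  have suf: "z' ! i = z ! (i + ?d)" if "?A \<le> i" for i
    using that by (auto simp: z z' nth_append)
  have len: "length z = length z' + ?d" "?A + ?L \<le> length z'" by (simp_all add: z z')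
  have left: "long_run M D U z a b \<longleftrightarrow> long_run M D U z' a b"
    if "a < ?A" "Suc b < ?A + M" for U a b
  proof
    assume run: "long_run M D U z a b"
    then have "a \<le> b" unfolding long_run_def by linarith
    then show "long_run M D U z' a b"
      using long_run_transfer[OF run refl] that pre len c by auto
  next
    assume run: "long_run M D U z' a b"
    then have "a \<le> b" unfolding long_run_def by linarith
    then show "long_run M D U z a b"
      using long_run_transfer[OF run refl] that pre len c by auto
  qed
  have right1: "long_run M D U z' (a - ?d) (b - ?d)"
    if "?A + ?d < a" "long_run M D U z a b" for U a b
    by (rule long_run_transfer[OF that(2)])
      (use that len suf[of "a - ?d - 1"] suf[of "Suc b - ?d"] suf in
        \<open>auto simp: long_run_def Suc_diff_le algebra_simps\<close>)
  have right2: "long_run M D U z (a + ?d) (b + ?d)"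
    if "?A < a" "long_run M D U z' a b" for U a b
    by (rule long_run_transfer[OF that(2)])
      (use that len suf[of "a - 1"] suf[of "Suc b"] suf in
        \<open>auto simp: long_run_def Suc_diff_le algebra_simps\<close>)
  have others: "a < ?A \<and> Suc b < ?A + M \<or> ?A + ?d < a \<and> ?A + M + ?d \<le> b"
    if "long_run M D U z a b" "(a, b) \<noteq> (a0, b0)" for U a b
    by (rule long_run_beside_window[OF that(1) P that(2) DM]) (use ab c in auto)
  have others': "a < ?A \<and> Suc b < ?A + M \<or> ?A + 0 < a \<and> ?A + M + 0 \<le> b"
    if "long_run M D U z' a b" "(a, b) \<noteq> (a0, b0 - ?d)" for U a b
    by (rule long_run_beside_window[OF that(1) P' that(2) DM]) (use ab c in auto)
  \<comment> \<open>Separate thresholds for start and end cover all three cases: the pattern around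
    the cut starts at \<open>?A\<close> or earlier and ends beyond the second threshold, so only its
    end moves.\<close>
  define \<Phi> where "\<Phi> = (\<lambda>(a, b). (if a \<le> ?A then a else a - ?d, if Suc b < ?A + M then b else b - ?d))"
  have \<Phi>0: "\<Phi> (a0, b0) = (a0, b0 - ?d)" using ab c by (auto simp: \<Phi>_def)
  have \<Phi>l: "\<Phi> (a, b) = (a, b)" if "a < ?A" "Suc b < ?A + M" for a b
    using that by (auto simp: \<Phi>_def)
  have \<Phi>r: "\<Phi> (a, b) = (a - ?d, b - ?d)" if "?A + ?d < a" "?A + M + ?d \<le> b" for a b
    using that by (auto simp: \<Phi>_def)
  let ?C = "check_patterns l t s"
  have setC: "set (?C w) = {(a, b). \<exists>T. long_run M D T w a b}" for w :: "'a list"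
    by (simp add: set_check_patterns M D)
  have "set (map \<Phi> (?C z)) = set (?C z')"
  proof (intro equalityI subsetI)
    fix w' assume "w' \<in> set (map \<Phi> (?C z))"
    then obtain a b U where w': "w' = \<Phi> (a, b)" and U: "long_run M D U z a b"
      by (auto simp: setC)
    consider "(a, b) = (a0, b0)" | "a < ?A" "Suc b < ?A + M" | "?A + ?d < a" "?A + M + ?d \<le> b"
      using others[OF U] by auto
    then show "w' \<in> set (?C z')"
    proof cases
      case 1
      then show ?thesis using P' \<Phi>0 w' by (auto simp: setC)
    next
      case 2
      then show ?thesis using left U \<Phi>l w' by (auto simp: setC)
    next
      case 3
      then show ?thesis using right1[OF _ U] \<Phi>r w' by (auto simp: setC)
    qed
  next
    fix w' assume "w' \<in> set (?C z')"
    then obtain a b U where w': "w' = (a, b)" and U: "long_run M D U z' a b"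
      by (auto simp: setC)
    consider "(a, b) = (a0, b0 - ?d)" | "a < ?A" "Suc b < ?A + M" | "?A < a" "?A + M \<le> b"
      using others'[OF U] by auto
    then have "\<exists>v \<in> set (?C z). \<Phi> v = w'"
    proof cases
      case 1
      then show ?thesis using P \<Phi>0 w' by (intro bexI[of _ "(a0, b0)"]) (auto simp: setC)
    next
      case 2
      then show ?thesis using left U \<Phi>l w' by (intro bexI[of _ "(a, b)"]) (auto simp: setC)
    next
      case 3
      then show ?thesis using right2[OF _ U] \<Phi>r w'
        by (intro bexI[of _ "(a + ?d, b + ?d)"]) (auto simp: setC)
    qed
    then show "w' \<in> set (map \<Phi> (?C z))" by auto
  qed
  moreover have "sorted_wrt (\<lambda>p p'. fst p < fst p') (map \<Phi> (?C z))"
    unfolding sorted_wrt_map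
  proof (rule sorted_wrt_mono_rel)
    show "sorted_wrt (\<lambda>p p'. fst p < fst p') (?C z)"
      by (rule sorted_check_patterns) (use DM M D in auto)
    fix v v' assume "v \<in> set (?C z)" "v' \<in> set (?C z)" and lt: "fst v < fst v'"
    then obtain a b U a' b' U' where *: "v = (a, b)" "v' = (a', b')"
      "long_run M D U z a b" "long_run M D U' z a' b'"
      by (auto simp: setC)
    \<comment> \<open>No pattern starts at any of the positions \<open>?A + 1\<close> to
      \<open>?A + ?d\<close>, so moving the later starts back by \<open>?d\<close> keeps the order
      strict.\<close>
    have "c \<le> ?A \<or> ?A + ?d < c" if "long_run M D U z c k" for c k U
      using others[OF that] ab(1) by (cases "(c, k) = (a0, b0)") auto
    then have "a \<le> ?A \<or> ?A + ?d < a" "a' \<le> ?A \<or> ?A + ?d < a'" using *(3,4) by blast+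
    then show "fst (\<Phi> v) < fst (\<Phi> v')" using lt by (auto simp: * \<Phi>_def)
  qed
  moreover have "sorted_wrt (\<lambda>p p'. fst p < fst p') (?C z')"
    by (rule sorted_check_patterns) (use DM M D in auto)
  ultimately have C': "?C z' = map \<Phi> (?C z)"
    by (intro sorted_wrt_same_set_imp_eq[of "\<lambda>p p'. fst p < fst p'"]) auto
  have "shortening (substring z a b) (substring z' (fst (\<Phi> (a, b))) (snd (\<Phi> (a, b))))"
    if U: "long_run M D U z a b" for a b U
  proof -
    have mp: "has_min_period U (substring z a b)" by (rule long_run_min_period[OF U])
    have same: ?thesis
      if "substring z' (fst (\<Phi> (a, b))) (snd (\<Phi> (a, b))) = substring z a b"
      using mp that by (auto simp: shortening_def)
    have blt: "b < length z" using U unfolding long_run_def by blast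
    consider "(a, b) = (a0, b0)" | "a < ?A" "Suc b < ?A + M" | "?A + ?d < a" "?A + M + ?d \<le> b"
      using others[OF U] by auto
    then show ?thesis
    proof cases
      case 1
      \<comment> \<open>\<open>Y\<close> is the part of the run behind \<open>e @ c\<close>; it
        survives, so the run loses exactly \<open>e\<close>, whose length \<open>T\<close>
        divides.\<close>
      define Y where "Y = take (Suc b0 - (?A + ?d + ?L)) \<beta>"
      have "b0 < length z" using blt 1 by simp
      then have "substring z a0 b0 = drop a0 \<alpha> @ e @ c @ Y"
        "substring z' a0 (b0 - ?d) = drop a0 \<alpha> @ c @ Y"
        using ab len c DM by (auto simp: substring_eq_take_drop z z' Y_def ac_simps)
      then have "burst_deletion T (substring z a0 b0) (substring z' a0 (b0 - ?d))"
        unfolding burst_deletion_def using e(1) dvd by blast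
      then show ?thesis
        using 1 \<Phi>0 long_run_min_period[OF P] long_run_min_period[OF P']
        by (auto simp: shortening_def deletion_of_min_periods_def)
    next
      case 2
      then show ?thesis
        by (intro same) (use pre \<Phi>l c in \<open>auto intro!: nth_equalityI simp: nth_substring\<close>)
    next
      case 3
      then show ?thesis
        by (intro same)
          (use suf \<Phi>r in \<open>auto intro!: nth_equalityI simp: nth_substring algebra_simps\<close>)
    qed
  qed
  then show ?thesis
    unfolding pattern_words_def C' list_all2_map1 list_all2_map2
    by (auto simp: list.rel_map setC case_prod_beta intro!: list.rel_refl_strong)
qed

lemma cut_rtranclp_pattern_words:
  assumes "(cut (l - 1 - s) (t - s))\<^sup>*\<^sup>* z z'"
    and DM: "t - s + 1 \<le> l - 1 - s" "2 * (t - s) \<le> l - 1 - s + 2"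
  shows "list_all2 shortening (pattern_words l t s z) (pattern_words l t s z')"
  using assms(1)
proof induction
  case base
  show ?case
    unfolding pattern_words_def list_all2_map1 list_all2_map2
    by (rule list.rel_refl_strong)
      (auto simp: set_check_patterns shortening_def intro: long_run_min_period)
next
  case (step y z')
  show ?case
    by (rule list_all2_trans[OF shortening_trans step.IH
          cut_pattern_words[OF step.hyps(2) refl refl DM]])
qed

lemma cut_append: "cut M D z z' \<Longrightarrow> cut M D (w @ z) (w @ z')"
  unfolding cut_def by (metis append.assoc)

lemma cut_rtranclp_append: "(cut M D)\<^sup>*\<^sup>* z z' \<Longrightarrow> (cut M D)\<^sup>*\<^sup>* (w @ z) (w @ z')"
  by (induction rule: rtranclp_induct) (auto intro: cut_append rtranclp.rtrancl_into_rtrancl)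

section \<open>Filling the gaps of a vector of reads\<close>

text \<open>\<open>ks\<close> lists how many entries go between neighbours; none go before the first
  or after the last. Fixing one embedding of \<open>R\<close> allows two extensions of the same
  vector to be compared gap by gap.\<close>

inductive filling :: "'b list \<Rightarrow> 'b list \<Rightarrow> nat list \<Rightarrow> bool" where
  single: "filling [r] [r] []"
| gap: "filling (r' # R) S ks \<Longrightarrow> filling (r # r' # R) (r # G @ S) (length G # ks)"

inductive_cases filling_ConsE: "filling (r # r' # R) S ks"
inductive_cases filling_singleE: "filling [r] S ks"

lemma filling_hd: "filling R S ks \<Longrightarrow> S \<noteq> [] \<and> hd S = hd R"
  by (cases rule: filling.cases) auto

lemma filling_length: "filling R S ks \<Longrightarrow> length S = length R + sum_list ks"
  by (induction rule: filling.induct) auto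

lemma filling_subseq: "filling R S ks \<Longrightarrow> subseq R S"
  by (induction rule: filling.induct) (auto intro: list_emb_append2)

text \<open>The final entry \<open>e\<close> anchors the embedding on the right. \<open>G\<close>
  collects what precedes the first matched entry and becomes a gap once another match is put in
  front.\<close>

lemma subseq_imp_filling_snoc:
  "subseq P Q \<Longrightarrow> \<exists>G S ks. Q @ [e] = G @ S \<and> filling (P @ [e]) S ks"
proof (induction rule: list_emb.induct)
  case (list_emb_Nil ys)
  show ?case using filling.single[of e] by auto
next
  case (list_emb_Cons xs ys y)
  then show ?case by (metis append_Cons)
next
  case (list_emb_Cons2 x y xs ys)
  then obtain G S ks where *: "ys @ [e] = G @ S" "filling (xs @ [e]) S ks" by blast
  obtain r' R where "xs @ [e] = r' # R" by (cases "xs @ [e]") auto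
  then have "filling (x # xs @ [e]) (x # G @ S) (length G # ks)" using filling.gap *(2) by metis
  then show ?case using *(1) list_emb_Cons2 by (metis append_Cons append_Nil)
qed

lemma subseq_imp_filling:
  assumes "subseq R S" "R \<noteq> []"
  shows "\<exists>X S' Y ks. S = X @ S' @ Y \<and> filling R S' ks"
proof -
  obtain P e where R: "R = P @ [e]" using assms(2) by (metis append_butlast_last_id)
  obtain U V where S: "S = U @ V" "subseq P U" "subseq [e] V"
    using assms(1) R by (metis list_emb_appendD)
  have "e \<in> set V" using S(3) by (simp add: subseq_singleton_left)
  then obtain V1 Y where V: "V = V1 @ e # Y" by (metis split_list)
  have "subseq P (U @ V1)" using S(2) by (simp add: list_emb_append2 list_emb_prefix)
  then obtain G S' ks where "(U @ V1) @ [e] = G @ S'" "filling R S' ks"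
    using subseq_imp_filling_snoc R by metis
  then have "S = G @ S' @ Y" using S(1) V
    by (metis append.assoc append_Cons append_Nil)
  then show ?thesis using \<open>filling R S' ks\<close> by blast
qed

lemma deletion_imp_filling:
  assumes "deletion t R R'" "length R \<ge> 2"
  shows "\<exists>ks. filling R' R ks \<and> sum_list ks = t"
proof -
  obtain K where K: "K \<subseteq> {0<..<length R - 1}" "card K = t" and R': "R' = nths R (- K)"
    using assms(1) unfolding deletion_def by blast
  obtain r Q0 where R0: "R = r # Q0" "Q0 \<noteq> []" using assms(2) by (cases R; cases "tl R") auto
  obtain Q e where R: "R = r # Q @ [e]" using R0 by (metis append_butlast_last_id)
  have "0 \<notin> K" "Suc (length Q) \<notin> K" using K(1) R by auto
  then have "R' = r # nths Q {j. Suc j \<in> - K} @ [e]"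
    using R' R by (simp add: nths_Cons nths_append)
  moreover have "subseq (nths Q {j. Suc j \<in> - K}) Q" by (auto simp: subseq_conv_nths)
  ultimately obtain P where P: "R' = r # P @ [e]" "subseq P Q" by blast
  obtain G S ks where *: "Q @ [e] = G @ S" "filling (P @ [e]) S ks"
    using subseq_imp_filling_snoc[OF P(2)] by blast
  obtain r' X where "P @ [e] = r' # X" by (cases "P @ [e]") auto
  then have f: "filling R' R (length G # ks)" using filling.gap *(1,2) P(1) R by metis
  have "{i. i < length R \<and> i \<in> - K} = {..<length R} - K" by auto
  moreover have "K \<subseteq> {..<length R}"
  proof
    fix i assume "i \<in> K"
    then have "i \<in> {0<..<length R - 1}" using K(1) by blast
    then show "i \<in> {..<length R}" by auto
  qed
  ultimately have "length R' = length R - t" "t \<le> length R"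
    using K(2) R' by (auto simp: length_nths card_Diff_subset finite_subset
        dest: card_mono[rotated])
  then show ?thesis using filling_length[OF f] f by auto
qed

section \<open>Consistency of fillings and the effect of minimality\<close>

lemma consistent_Cons:
  "S \<noteq> [] \<Longrightarrow> consistent (r # S) \<longleftrightarrow> tl r = butlast (hd S) \<and> consistent S"
  by (cases S) (auto simp: consistent_def)

lemma consistent_appendD: "consistent (X @ S) \<Longrightarrow> consistent X \<and> consistent S"
  by (auto simp: consistent_def successively_append_iff)

text \<open>Consistency compares adjacent reads only, so what precedes the tail sees nothing of it
  but its head.\<close>

lemma consistent_filled_gap_cong:
  assumes "consistent (r # G @ S)" "consistent S'" "S \<noteq> []" "S' \<noteq> []" "hd S' = hd S"
  shows "consistent (r # G @ S')"
  using assms successively_append_iff[of _ "r # G" S] successively_append_iff[of _ "r # G" S']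
  by (simp add: consistent_def)

text \<open>Each gap is bounded by the same two reads in both fillings, so the shorter filler can be
  chosen independently at every gap.\<close>

lemma filling_min:
  assumes "filling R S ks" "filling R S' js" "consistent S" "consistent S'"
  shows "\<exists>S''. filling R S'' (map2 min ks js) \<and> consistent S'' \<and> set S'' \<subseteq> set S \<union> set S'"
  using assms
proof (induction arbitrary: S' js rule: filling.induct)
  case (single r)
  then show ?case by (auto elim!: filling_singleE intro: filling.single)
next
  case (gap r' R S ks r G)
  obtain H S1 js1 where S': "S' = r # H @ S1" "js = length H # js1" "filling (r' # R) S1 js1"
    using gap.prems(1) by (auto elim: filling_ConsE)
  have con: "consistent S" "consistent S1"
    using gap.prems(2,3) S'(1) consistent_appendD[of "r # G" S] consistent_appendD[of "r # H" S1]
    by auto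
  then obtain S'' where S'': "filling (r' # R) S'' (map2 min ks js1)" "consistent S''"
    "set S'' \<subseteq> set S \<union> set S1"
    using gap.IH[OF S'(3)] by blast
  note hds = filling_hd[OF gap.hyps] filling_hd[OF S'(3)] filling_hd[OF S''(1)]
  define F where "F = (if length G \<le> length H then G else H)"
  have "consistent (r # F @ S'')"
    using consistent_filled_gap_cong[of r G S S''] consistent_filled_gap_cong[of r H S1 S'']
      gap.prems S' hds S''(2) by (auto simp: F_def)
  moreover have "filling (r # r' # R) (r # F @ S'') (length F # map2 min ks js1)"
    by (rule filling.gap[OF S''(1)])
  moreover have "length F = min (length G) (length H)" by (simp add: F_def)
  moreover have "set (r # F @ S'') \<subseteq> set (r # G @ S) \<union> set S'"
    using S''(3) S'(1) by (auto simp: F_def)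
  ultimately show ?case using S'(2) by (intro exI[of _ "r # F @ S''"]) simp
qed

lemma filling_length_gaps: "filling R S ks \<Longrightarrow> length R = Suc (length ks)"
  by (induction rule: filling.induct) auto

text \<open>The equality case is the point: a pointwise minimum that does not lower the sum of
  \<open>js\<close> is \<open>js\<close> itself.\<close>

lemma sum_list_map2_min:
  "length ks = length js \<Longrightarrow>
     sum_list (map2 min ks js) \<le> sum_list (js :: nat list) \<and>
     (sum_list js \<le> sum_list (map2 min ks js) \<longrightarrow> list_all2 (\<le>) js ks)"
  by (induction ks js rule: list_induct2) auto

text \<open>Filling each gap by the shorter of the two available fillings is again consistent.
  Hence in a minimum insertion no gap receives more reads than were deleted there.\<close>

lemma min_consistent_insertion_filling:
  assumes min: "min_consistent_insertion q l s R' R''"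
    and R: "filling R' R ks" "consistent R" "set R \<subseteq> seqs q l"
  shows "\<exists>js. filling R' R'' js \<and> sum_list js = s \<and> list_all2 (\<le>) js ks"
proof -
  have ins: "set R'' \<subseteq> seqs q l" "consistent R''" "subseq R' R''" "length R'' = length R' + s"
    and least: "\<And>s' S. consistent_insertion q l s' R' S \<Longrightarrow> s \<le> s'"
    using min by (auto simp: min_consistent_insertion_def consistent_insertion_def)
  have least': "s \<le> sum_list js"
    if "filling R' S js" "consistent S" "set S \<subseteq> seqs q l" for S js
    by (rule least[of _ S])
      (use that filling_length filling_subseq in \<open>auto simp: consistent_insertion_def\<close>)
  have "R' \<noteq> []" using filling_length_gaps[OF R(1)] by auto
  then obtain X S Y js where S: "R'' = X @ S @ Y" "filling R' S js"
    using subseq_imp_filling[OF ins(3)] by blast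
  have "consistent S" using ins(2) S(1) consistent_appendD by metis
  moreover have "set S \<subseteq> seqs q l" using ins(1) S(1) by auto
  ultimately have "s \<le> sum_list js" by (rule least'[OF S(2)])
  \<comment> \<open>Dropping \<open>X\<close> and \<open>Y\<close> would leave a consistent
    insertion, so minimality of \<open>s\<close> makes them empty.\<close>
  then have [simp]: "X = []" "Y = []" and js: "sum_list js = s"
    using filling_length[OF S(2)] ins(4) S(1) by auto
  have f: "filling R' R'' js" using S by simp
  obtain S' where S': "filling R' S' (map2 min ks js)" "consistent S'" "set S' \<subseteq> set R \<union> set R''"
    using filling_min[OF R(1) f R(2) ins(2)] by blast
  have "s \<le> sum_list (map2 min ks js)"
    by (rule least'[OF S'(1,2)]) (use S'(3) ins(1) R(3) in auto)
  then have "list_all2 (\<le>) js ks"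
    using sum_list_map2_min[of ks js] js filling_length_gaps[OF f] filling_length_gaps[OF R(1)]
    by auto
  then show ?thesis using f js by blast
qed

section \<open>From reads to words\<close>

lemma inv_read_vector_Cons:
  assumes "consistent (r # S)" "S \<noteq> []" "r \<noteq> []" "hd S \<noteq> []"
  shows "inv_read_vector (r # S) = hd r # inv_read_vector S"
proof -
  obtain r' S' where S: "S = r' # S'" using assms(2) by (cases S) auto
  have "r = hd r # butlast r'" using assms by (simp add: consistent_def S) (metis list.collapse)
  moreover have "butlast r' @ [last r'] = r'" using assms(4) S by simp
  ultimately show ?thesis
    by (simp add: inv_read_vector_def S) (metis append.assoc append_Cons append_Nil)
qed

text \<open>Consistency lets a word be spelled by first letters instead of last ones. The front part
  \<open>G\<close> then contributes one letter per read, and the rest its own word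
  unchanged.\<close>

lemma inv_read_vector_append:
  assumes "consistent (G @ S)" "S \<noteq> []" "\<And>r. r \<in> set (G @ S) \<Longrightarrow> r \<noteq> []"
  shows "inv_read_vector (G @ S) = map hd G @ inv_read_vector S"
  using assms
proof (induction G)
  case (Cons g G)
  have "consistent (G @ S)" using consistent_appendD[of "[g]" "G @ S"] Cons.prems by simp
  moreover have "hd (G @ S) \<in> set (G @ S)" using Cons.prems(2) by (intro hd_in_set) simp
  ultimately show ?case
    using Cons inv_read_vector_Cons[of g "G @ S"] by simp
qed simp

lemma read_vector_Cons:
  assumes "l \<le> length z"
  shows "read_vector l (x # z) = take l (x # z) # read_vector l z"
  using assms unfolding read_vector_def
  by (simp add: upt_conv_Cons Suc_diff_le map_Suc_upt[symmetric] del: upt_Suc map_Suc_upt)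

lemma read_vector_single: "length z = l \<Longrightarrow> read_vector l z = [z]"
  by (simp add: read_vector_def)

lemma hd_read_vector: "hd (read_vector l z) = take l z"
  by (simp add: read_vector_def upt_conv_Cons del: upt_Suc)

lemma read_vector_not_Nil: "read_vector l z \<noteq> []"
  by (simp add: read_vector_def)

lemma read_vector_consistent_inverse:
  assumes "l \<ge> 1" "l \<le> length z"
  shows "consistent (read_vector l z) \<and> inv_read_vector (read_vector l z) = z"
  using assms(2)
proof (induction z)
  case (Cons x z)
  show ?case
  proof (cases "length z < l")
    case True
    then have "length (x # z) = l" using Cons.prems by simp
    then show ?thesis
      by (simp add: read_vector_single consistent_def inv_read_vector_def del: length_Cons)
  next
    case False
    then have le: "l \<le> length z" by simp
    have "tl (take l (x # z)) = butlast (take l z)"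
      using assms(1) le by (cases l) (auto simp: butlast_take)
    then have con: "consistent (take l (x # z) # read_vector l z)"
      using Cons.IH le by (simp add: consistent_Cons read_vector_not_Nil hd_read_vector)
    have "z \<noteq> []" "hd (take l (x # z)) = x" using assms(1) le by (auto simp: hd_take)
    then have "inv_read_vector (take l (x # z) # read_vector l z) = x # z"
      using inv_read_vector_Cons[OF con] Cons.IH le assms(1)
      by (simp add: read_vector_not_Nil hd_read_vector)
    then show ?thesis using con by (simp add: read_vector_Cons[OF le])
  qed
qed (use assms(1) in simp)

lemma set_read_vector: "set z \<subseteq> {..<q} \<Longrightarrow> l \<le> length z \<Longrightarrow> set (read_vector l z) \<subseteq> seqs q l"
  by (auto simp: read_vector_def seqs_def dest!: in_set_takeD in_set_dropD)

section \<open>From two fillings of the same gaps to cuts\<close>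

lemma append_eq_imp_eq_take: "g @ x = r @ y \<Longrightarrow> length g \<le> length r \<Longrightarrow> g = take (length g) r"
  by (metis append_eq_append_conv_if append_eq_conv_conj)

text \<open>Both gap fillings lead from the read \<open>r\<close> to the read \<open>r'\<close>, at distances
  \<open>length g\<close> and \<open>length h\<close>. So \<open>r'\<close> overlaps \<open>r\<close> at two
  offsets, which makes the overlap periodic.\<close>

lemma cut_two_overlaps:
  assumes "g @ r' = r @ \<gamma>" "h @ r' = r @ \<eta>" "length r = l" "length r' = l"
    and "length h < length g" "length g \<le> l" "length g \<le> length h + D" "M + length h \<le> l"
  shows "cut M D (g @ r' @ \<tau>) (h @ r' @ \<tau>)"
proof -
  define e where "e = drop (length h) g"
  \<comment> \<open>\<open>L\<close> is the length of the overlap of \<open>r\<close> and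
    \<open>r'\<close> at the smaller distance, and \<open>c\<close> the overlapping word.\<close>
  define L where "L = l - length h"
  define c where "c = take L r'"
  have "g = take (length g) r" "h = take (length h) r"
    by (rule append_eq_imp_eq_take[OF assms(1)], use assms(3,6) in simp)
      (rule append_eq_imp_eq_take[OF assms(2)], use assms(3,5,6) in simp)
  then have "take (length h) g = h"
    using assms(5) by (metis less_imp_le_nat min.absorb1 take_take)
  then have g: "g = h @ e"
    unfolding e_def by (metis append_take_drop_id)
  have ne: "e \<noteq> []" "length e \<le> D" "length e \<le> L" using assms(5-8) by (auto simp: e_def L_def)
  have r1: "r = g @ take (l - length g) r'"
    using arg_cong[OF assms(1), of "take l"] assms(3,6) by simp
  have r2: "r = h @ c"
    using arg_cong[OF assms(2), of "take l"] assms(3,5,6) by (simp add: c_def L_def)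
  have len: "l - length g = L - length e" using g by (simp add: L_def)
  \<comment> \<open>Both decompositions of \<open>r\<close> begin with \<open>h\<close>; after
    cancelling it, what follows \<open>e\<close> is a prefix of \<open>r'\<close>, hence of
    \<open>c\<close>.\<close>
  have "c = e @ take (L - length e) r'" using r1 r2 g len by simp
  moreover have "take (L - length e) r' @ drop (L - length e) c = c"
    unfolding c_def by (metis append_take_drop_id diff_le_self min.absorb1 take_take)
  ultimately have ec: "e @ c = c @ drop (L - length e) c" by (metis append.assoc)
  have r': "r' = c @ drop L r'" by (simp add: c_def)
  have "length c = L" using assms(4) by (simp add: c_def L_def)
  then have "M \<le> length c" using assms(8) by (simp add: L_def)
  moreover have "g @ r' @ \<tau> = h @ e @ c @ drop L r' @ \<tau>" "h @ r' @ \<tau> = h @ c @ drop L r' @ \<tau>"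
    using g r' by (metis append.assoc)+
  ultimately show ?thesis
    unfolding cut_def using ec ne(1,2) by blast
qed

text \<open>Gaps are handled from the right: the word of the tail is cut behind the unchanged first
  gap, then the first gap is shortened by one cut, or kept if the sizes agree. A filler of
  \<open>k\<close> reads puts the next read at distance \<open>k + 1\<close>, hence the
  \<open>Suc\<close> in the bound for \<open>M\<close>.\<close>

lemma filling_cut:
  assumes "filling R' R ks" "filling R' S js" "consistent R" "consistent S"
    and "\<And>r. r \<in> set R \<union> set S \<Longrightarrow> length r = l"
    and "list_all2 (\<le>) js ks" "sum_list ks \<le> sum_list js + D" "sum_list ks < l"
    and "M + Suc (sum_list js) \<le> l"
  shows "(cut M D)\<^sup>*\<^sup>* (inv_read_vector R) (inv_read_vector S)"
  using assms
proof (induction arbitrary: S js rule: filling.induct)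
  case (single r)
  then show ?case by (auto elim!: filling_singleE)
next
  case (gap r' R' R ks r G)
  obtain H S1 js1 where S: "S = r # H @ S1" "js = length H # js1" "filling (r' # R') S1 js1"
    using gap.prems(1) by (auto elim: filling_ConsE)
  have con: "consistent R" "consistent S1"
    using gap.prems(2,3) S(1) consistent_appendD[of "r # G" R] consistent_appendD[of "r # H" S1]
    by auto
  have le: "length H \<le> length G" "list_all2 (\<le>) js1 ks" using gap.prems(5) S(2) by auto
  \<comment> \<open>No gap is larger in \<open>S\<close> than in \<open>R\<close>, so the bound
    \<open>D\<close> on the total difference holds for the first gap and for the tail
    separately.\<close>
  have sum_le: "sum_list js1 \<le> sum_list ks"
    using le(2) by (induction rule: list_all2_induct) auto
  have ne: "w \<noteq> []" if "w \<in> set (r # G @ R) \<union> set S" for w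
    using gap.prems(4)[OF that] gap.prems(7) by auto
  note hdR = filling_hd[OF gap.hyps] and hdS = filling_hd[OF S(3)]
  let ?g = "map hd (r # G)" and ?h = "map hd (r # H)"
  obtain S2 where S2: "S1 = r' # S2" using hdS by (cases S1) auto
  define \<tau> where "\<tau> = map last S2"
  have invS1: "inv_read_vector S1 = r' @ \<tau>" by (simp add: inv_read_vector_def S2 \<tau>_def)
  have invR: "inv_read_vector (r # G @ R) = ?g @ inv_read_vector R"
    using inv_read_vector_append[of "r # G" R] gap.prems(2) hdR ne by auto
  have invS: "inv_read_vector S = ?h @ inv_read_vector S1"
    using inv_read_vector_append[of "r # H" S1] gap.prems(3) hdS ne S(1) by auto
  have "(cut M D)\<^sup>*\<^sup>* (inv_read_vector R) (inv_read_vector S1)"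
    by (rule gap.IH[OF S(3)]) (use con gap.prems(4-8) S le sum_le in auto)
  then have 1: "(cut M D)\<^sup>*\<^sup>* (inv_read_vector (r # G @ R)) (?g @ r' @ \<tau>)"
    unfolding invR invS1[symmetric] by (rule cut_rtranclp_append)
  \<comment> \<open>Stated for any filler and tail, to serve both fillings: the word from
    \<open>r\<close> to \<open>r'\<close> begins with \<open>r\<close>.\<close>
  have overlap: "\<exists>\<gamma>. map hd (r # F) @ r' = r @ \<gamma>"
    if F: "consistent (r # F @ Q)" "Q \<noteq> []" "hd Q = r'" "set (r # F @ Q) \<subseteq> set (r # G @ R) \<union> set S"
    for F Q
  proof -
    obtain Q' where Q: "Q = r' # Q'" using F(2,3) by (cases Q) auto
    have "consistent ((r # F) @ [r'])"
      using consistent_appendD[of "(r # F) @ [r']" Q'] F(1) Q by simp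
    then have "map hd (r # F) @ inv_read_vector [r'] = inv_read_vector ((r # F) @ [r'])"
      by (intro inv_read_vector_append[symmetric]) (use ne F(4) Q in auto)
    then show ?thesis by (auto simp: inv_read_vector_def)
  qed
  obtain \<gamma> where \<gamma>: "?g @ r' = r @ \<gamma>"
    using overlap[of G R] gap.prems(2) hdR by auto
  obtain \<eta> where \<eta>: "?h @ r' = r @ \<eta>"
    using overlap[of H S1] gap.prems(3) hdS S(1) by auto
  have lr: "length r = l" "length r' = l" using gap.prems(4) S(1) S2 by auto
  have 2: "(cut M D)\<^sup>*\<^sup>* (?g @ r' @ \<tau>) (?h @ r' @ \<tau>)"
  proof (cases "length H = length G")
    case True
    then have "?g = ?h"
      using append_eq_imp_eq_take[OF \<gamma>] append_eq_imp_eq_take[OF \<eta>] lr gap.prems(7) by simp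
    then show ?thesis by simp
  next
    case False
    have "cut M D (?g @ r' @ \<tau>) (?h @ r' @ \<tau>)"
      by (rule cut_two_overlaps[OF \<gamma> \<eta> lr]) (use False le sum_le gap.prems(6-8) S(2) in auto)
    then show ?thesis by simp
  qed
  show ?case using rtranclp_trans[OF 1 2] by (simp add: invS invS1)
qed

theorem mainTheorem11:
  fixes q n l t s :: nat and u x v xt y :: "nat list" and R' R'' :: "nat list list"
  assumes "q \<ge> 2"
    and "u \<in> seqs q l" and "v \<in> seqs q l" and "x \<in> seqs q n"
    and "xt = u @ x @ v"
    and "1 \<le> t" and "t \<le> l - 2" and "2 * t \<le> l + 1 + s" and "s < t"
    and "deletion t (read_vector l xt) R'"
    and "min_consistent_insertion q l s R' R''"
    and "y = inv_read_vector R''"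
  shows "length (check_patterns l t s xt) = length (check_patterns l t s y)
    \<and> (\<forall>i < length (check_patterns l t s y). \<forall>a b a' b' p p'.
         check_patterns l t s xt ! i = (a, b) \<longrightarrow> p = substring xt a b \<longrightarrow>
         check_patterns l t s y ! i = (a', b') \<longrightarrow> p' = substring y a' b' \<longrightarrow>
           (\<exists>T. has_min_period T p \<and> has_min_period T p') \<and>
           (p' = p \<or> deletion_of_min_periods p p'))"
proof -
  have l: "l \<ge> 3" using assms(6,7) by simp
  have xt: "set xt \<subseteq> {..<q}" "length xt = l + n + l"
    using assms(2-5) by (auto simp: seqs_def)
  let ?R = "read_vector l xt"
  have con: "consistent ?R" and inv: "inv_read_vector ?R = xt"
    using read_vector_consistent_inverse[of l xt] xt(2) l by auto
  have setR: "set ?R \<subseteq> seqs q l" by (rule set_read_vector) (use xt in auto)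
  have "length ?R \<ge> 2" using xt(2) l by (simp add: read_vector_def)
  then obtain ks where ks: "filling R' ?R ks" "sum_list ks = t"
    using deletion_imp_filling[OF assms(10)] by blast
  obtain js where js: "filling R' R'' js" "sum_list js = s" "list_all2 (\<le>) js ks"
    using min_consistent_insertion_filling[OF assms(11) ks(1) con setR] by blast
  have R'': "consistent R''" "set R'' \<subseteq> seqs q l"
    using assms(11) by (auto simp: min_consistent_insertion_def consistent_insertion_def)
  \<comment> \<open>At most \<open>s\<close> reads fill any gap of \<open>R'\<close> in
    \<open>R''\<close>, so its bounding reads overlap there in at least \<open>l - 1 - s\<close>
    letters.\<close>
  have "(cut (l - 1 - s) (t - s))\<^sup>*\<^sup>* (inv_read_vector ?R) (inv_read_vector R'')"
    by (rule filling_cut[OF ks(1) js(1) con R''(1), of l])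
      (use ks js setR R''(2) assms(7,9) l in \<open>auto simp: seqs_def\<close>)
  then have "(cut (l - 1 - s) (t - s))\<^sup>*\<^sup>* xt y" by (simp only: inv assms(12))
  \<comment> \<open>For \<open>M = l - 1 - s\<close> and \<open>D = t - s\<close>, the bound
    \<open>t \<le> l - 2\<close> gives \<open>D + 1 \<le> M\<close>, and
    \<open>2 * t \<le> l + 1 + s\<close> gives \<open>2 * D \<le> M + 2\<close>.\<close>
  then have "list_all2 shortening (pattern_words l t s xt) (pattern_words l t s y)"
    by (rule cut_rtranclp_pattern_words) (use assms(6-9) l in auto)
  then have L: "list_all2
      (\<lambda>c c'. shortening (substring xt (fst c) (snd c)) (substring y (fst c') (snd c')))
      (check_patterns l t s xt) (check_patterns l t s y)"
    by (simp add: pattern_words_def list_all2_map1 list_all2_map2 case_prod_beta)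
  then show ?thesis
    using list_all2_lengthD[OF L] list_all2_nthD2[OF L] unfolding shortening_def by fastforce
qed

end
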